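(* Let $f:(\{0,1\}^n)^k\to\{0,1\}$ be a $k$-argument function, and assume that $f$ has a fooling set of size $t$ (i.e., a $b$-fooling set of size $t$ for some $b\in\{0,1\}$). Then $\operatorname{rank}(M_f)\ge t^{1/(2^k-2)}$.
   Context: For $x,z\in(\{0,1\}^n)^k$ and a partition $A,B$ of $[k]$, $\sigma^{A,B}(x,z)\in(\{0,1\}^n)^k$ is the tuple whose $i$-th entry is $x_i$ if $i\in A$ and $z_i$ if $i\in B$. A set $F\subseteq(\{0,1\}^n)^k$ is a $b$-fooling set for $f$ if (i) $f(x)=b$ for all $x\in F$, and (ii) for all $x\neq z$ in $F$, $f(\sigma^{A,B}(x,z))=1-b$ for some partition $A,B$ of $[k]$. $M_f$ is the $k$-dimensional array with $M_f[x_1,\dots,x_k]=f(x_1,\dots,x_k)$, and $\operatorname{rank}(M_f)$ is its tensor rank over the reals (minimal number of pure tensors $v_1\otimes\cdots\otimes v_k$ summing to it).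
   Formalization: For 0-fooling sets the printed bound is false (AND with n=1, k=2, F={(1,0),(0,1)}: rank 1 < 2^{1/2}), so for b=0 it is stated as rank(M_f)+1 ≥ t^{1/(2^k-2)}; b=1 is as printed. k ≥ 2 is assumed since the exponent is undefined for k=1, and n ≥ 1. *)

theory Defs
  imports "HOL-Analysis.Analysis"
begin

text \<open>
  The type variable \<open>'k\<close> plays the role of the index set [k] and \<open>'n\<close> that of [n], so that
  \<open>bool ^ 'n ^ 'k\<close> is the set of k-tuples of n-bit strings; bits are Booleans, and 1 - b is \<open>\<not> b\<close>.
\<close>

definition mix :: "'k set \<Rightarrow> 'k set \<Rightarrow> 'a ^ 'k \<Rightarrow> 'a ^ 'k \<Rightarrow> 'a ^ ('k::finite)" where
  "mix A B x z = (\<chi> i. if i \<in> A then x $ i else if i \<in> B then z $ i else undefined)"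

definition fooling_set ::
  "bool \<Rightarrow> (bool ^ 'n ^ 'k \<Rightarrow> bool) \<Rightarrow> (bool ^ ('n::finite) ^ ('k::finite)) set \<Rightarrow> bool" where
  "fooling_set b f F \<longleftrightarrow>
     (\<forall>x\<in>F. f x = b) \<and>
     (\<forall>x\<in>F. \<forall>z\<in>F. x \<noteq> z \<longrightarrow>
        (\<exists>A B. A \<union> B = UNIV \<and> A \<inter> B = {} \<and> f (mix A B x z) = (\<not> b)))"

definition pure_tensor :: "('k \<Rightarrow> 'a \<Rightarrow> real) \<Rightarrow> 'a ^ ('k::finite) \<Rightarrow> real" where
  "pure_tensor v x = (\<Prod>i\<in>UNIV. v i (x $ i))"

definition tensor_rank :: "(('a::finite) ^ ('k::finite) \<Rightarrow> real) \<Rightarrow> nat" where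
  "tensor_rank M =
     (LEAST r. \<exists>v :: nat \<Rightarrow> 'k \<Rightarrow> 'a \<Rightarrow> real. \<forall>x. M x = (\<Sum>j<r. pure_tensor (v j) x))"

text \<open>Every array has a decomposition, so the minimum above is attained.\<close>

lemma tensor_rank_attained:
  fixes M :: "('a::finite) ^ ('k::finite) \<Rightarrow> real"
  shows "\<exists>v :: nat \<Rightarrow> 'k \<Rightarrow> 'a \<Rightarrow> real. \<forall>x. M x = (\<Sum>j<tensor_rank M. pure_tensor (v j) x)"
proof -
  have unit: "pure_tensor (\<lambda>i a. of_bool (a = y $ i)) x = of_bool (x = y)"
    for x y :: "'a ^ 'k"
    by (auto simp: pure_tensor_def vec_eq_iff)
  obtain i0 :: 'k where True by simp
  have scaled: "pure_tensor (\<lambda>i a. (if i = i0 then M y else 1) * of_bool (a = y $ i)) x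
      = M y * of_bool (x = y)" for x y
    using unit[of y x] by (simp add: pure_tensor_def prod.distrib)
  obtain e :: "nat \<Rightarrow> 'a ^ 'k" where e: "bij_betw e {..<CARD('a ^ 'k)} UNIV"
    using ex_bij_betw_nat_finite[of "UNIV :: ('a ^ 'k) set"] by (auto simp: atLeast0LessThan)
  have "M x = (\<Sum>j<CARD('a ^ 'k).
      pure_tensor (\<lambda>i a. (if i = i0 then M (e j) else 1) * of_bool (a = e j $ i)) x)" for x
    unfolding scaled using sum.reindex_bij_betw[OF e, of "\<lambda>y. M y * of_bool (x = y)"]
    by (simp add: of_bool_def if_distrib cong: if_cong)
  then have "\<exists>r. \<exists>v :: nat \<Rightarrow> 'k \<Rightarrow> 'a \<Rightarrow> real. \<forall>x. M x = (\<Sum>j<r. pure_tensor (v j) x)"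
    by (intro exI[of _ "CARD('a ^ 'k)"]
        exI[of _ "\<lambda>j i a. (if i = i0 then M (e j) else 1) * of_bool (a = e j $ i)"]) blast
  then show ?thesis
    unfolding tensor_rank_def by (rule LeastI_ex)
qed

definition array_of :: "(bool ^ 'n ^ 'k \<Rightarrow> bool) \<Rightarrow> bool ^ ('n::finite) ^ ('k::finite) \<Rightarrow> real" where
  "array_of f x = of_bool (f x)"

text \<open>
  For 0-fooling sets, t to the power 1/(2^k - 2) does not bound the rank of \<open>f\<close> itself: the
  conjunction of all bits has rank at most 1, but it has a 0-fooling set of size 2 for every
  k at least 2 and every n. The bound for 0-fooling sets is therefore stated for rank + 1,
  which dominates the rank of the array of the negated function.
\<close>

lemma zero_fooling_bound_fails:
  assumes k: "CARD('k::finite) \<ge> 2"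
  shows "\<exists>(f :: bool ^ 'n ^ 'k \<Rightarrow> bool) F.
           fooling_set False f F \<and> card F = 2 \<and>
           \<not> real (tensor_rank (array_of f)) \<ge> real (card F) powr (1 / (2 ^ CARD('k) - 2))"
proof -
  let ?f = "\<lambda>x :: bool ^ ('n::finite) ^ 'k. \<forall>i j. x $ i $ j"
  obtain p q :: 'k where "p \<noteq> q"
    using k card_le_Suc0_iff_eq[of "UNIV :: 'k set"] by fastforce
  define x :: "bool ^ 'n ^ 'k" where "x = (\<chi> i j. i \<noteq> p)"
  define z :: "bool ^ 'n ^ 'k" where "z = (\<chi> i j. i = p)"
  have xz: "x \<noteq> z" by (simp add: x_def z_def vec_eq_iff)
  have 1: "?f (mix (- {p}) {p} x z)" "?f (mix {p} (- {p}) z x)"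
    by (auto simp: mix_def x_def z_def)
  have 2: "\<not> ?f x" "\<not> ?f z"
    using \<open>p \<noteq> q\<close> by (auto simp: x_def z_def)
  have "fooling_set False ?f {x, z}"
    unfolding fooling_set_def using 1 2
    by (auto intro: exI[of _ "- {p}"] exI[of _ "{p}"])
  moreover have card: "card {x, z} = 2" using xz by simp
  moreover have "tensor_rank (array_of ?f) \<le> 1"
    unfolding tensor_rank_def
  proof (rule Least_le, intro exI allI)
    fix y :: "bool ^ 'n ^ 'k"
    show "array_of ?f y = (\<Sum>j<1::nat. pure_tensor ((\<lambda>_ _ a. of_bool (\<forall>l. a $ l)) j) y)"
    proof (cases "?f y")
      case True
      then have "pure_tensor (\<lambda>_ a. of_bool (\<forall>l. a $ l)) y = 1"
        unfolding pure_tensor_def by (intro prod.neutral) auto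
      moreover have "array_of ?f y = 1"
        using True by (simp add: array_of_def)
      ultimately show ?thesis by simp
    qed (auto simp: array_of_def pure_tensor_def)
  qed
  moreover have "(1::real) < 2 powr (1 / (2 ^ CARD('k) - 2))"
  proof -
    have "(2::real) ^ 2 \<le> 2 ^ CARD('k)" using k by (intro power_increasing) auto
    then show ?thesis by simp
  qed
  ultimately show ?thesis
    by (intro exI[of _ ?f] exI[of _ "{x, z}"]) (auto simp: card)
qed

end

(* For a 1-fooling set F and each nonempty proper subset A of [k], a rank-r decomposition of M_f
   splits f(mix A (-A) x z) into a sum of r products u(x) w(z), i.e. it is an F-by-F matrix of
   rank at most r. The trivial partitions return x or z themselves, where f is 1, so the
   entrywise product of these 2^k - 2 matrices is the identity; hence t \<le> r^(2^k - 2).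
   A 0-fooling set for f is a 1-fooling set for the negation of f, whose array is the all-ones
   pure tensor minus M_f. *)

theory Submission
  imports Defs
begin

text \<open>An identity matrix indexed by \<open>F\<close> has rank \<open>card F\<close>: each unit
  vector at a point of \<open>F\<close> is a combination of \<open>card S\<close> fixed vectors, and
  independent vectors in such a span number at most \<open>card S\<close>.\<close>

lemma card_le_if_biorthogonal_sum:
  fixes F :: "'x::finite set" and u w :: "'s \<Rightarrow> 'x \<Rightarrow> real"
  assumes "finite S"
    and id: "\<And>x z. x \<in> F \<Longrightarrow> z \<in> F \<Longrightarrow> (\<Sum>s\<in>S. u s x * w s z) = of_bool (x = z)"
  shows "card F \<le> card S"
proof -
  let ?e = "\<lambda>x. axis x (1::real)"
  \<comment> \<open>The hypothesis speaks only about points of \<open>F\<close>. Zeroing the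
    coordinates outside \<open>F\<close> makes the combination with coefficients
    \<open>u s x\<close> agree with the unit vector everywhere.\<close>
  define W :: "'s \<Rightarrow> real ^ 'x" where "W s = (\<chi> z. of_bool (z \<in> F) * w s z)" for s
  have "?e x \<in> span (W ` S)" if "x \<in> F" for x
  proof -
    have "?e x $ z = (\<Sum>s\<in>S. u s x *\<^sub>R W s) $ z" for z
    proof (cases "z \<in> F")
      case True
      then show ?thesis using id[OF that, of z] by (simp add: W_def axis_def)
    qed (use that in \<open>auto simp: W_def axis_def\<close>)
    then have "?e x = (\<Sum>s\<in>S. u s x *\<^sub>R W s)"
      by (simp add: vec_eq_iff)
    then show ?thesis
      by (simp add: span_sum span_scale span_base)
  qed
  moreover have "independent (?e ` F)"
    by (rule independent_mono[OF independent_Basis]) (auto simp: Basis_vec_def)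
  ultimately have "card (?e ` F) \<le> card (W ` S)"
    using \<open>finite S\<close> by (intro independent_span_bound[THEN conjunct2]) auto
  also have "card (?e ` F) = card F"
    by (intro card_image) (auto simp: inj_on_def axis_eq_axis)
  also have "card (W ` S) \<le> card S"
    using \<open>finite S\<close> by (rule card_image_le)
  finally show ?thesis .
qed

text \<open>Each coordinate is read from only one of the two arguments, so for fixed
  \<open>A\<close> a pure tensor becomes a matrix of rank at most one in \<open>x\<close> and
  \<open>z\<close>.\<close>

lemma pure_tensor_mix:
  "pure_tensor v (mix A (- A) x z) = (\<Prod>i\<in>A. v i (x $ i)) * (\<Prod>i\<in>- A. v i (z $ i))"
proof -
  have "pure_tensor v (mix A (- A) x z) =
      (\<Prod>i\<in>A. v i (mix A (- A) x z $ i)) * (\<Prod>i\<in>- A. v i (mix A (- A) x z $ i))"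
    unfolding pure_tensor_def by (subst prod.union_disjoint[symmetric]) auto
  then show ?thesis
    by (simp add: mix_def)
qed

lemma mix_trivial [simp]: "mix UNIV {} x z = x" "mix {} UNIV x z = z"
  by (simp_all add: mix_def)

lemma card_one_fooling_set_le:
  fixes f :: "bool ^ ('n::finite) ^ ('k::finite) \<Rightarrow> bool"
  assumes F: "fooling_set True f F"
    and v: "\<And>x. array_of f x = (\<Sum>j<r. pure_tensor (v j) x)"
  shows "card F \<le> r ^ (2 ^ CARD('k) - 2)"
proof -
  define P :: "'k set set" where "P = Pow UNIV - {{}, UNIV}"
  \<comment> \<open>Multiplying out the product over \<open>P\<close> of sums of \<open>r\<close>
    terms gives one term per choice function \<open>h\<close>, which picks the summand
    \<open>h A\<close> for each \<open>A\<close>. Every such term is again a function of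
    \<open>x\<close> times a function of \<open>z\<close>.\<close>
  define S where "S = PiE P (\<lambda>_. {..<r})"
  define u where "u h x = (\<Prod>A\<in>P. \<Prod>i\<in>A. v (h A) i (x $ i))" for h and x :: "bool ^ 'n ^ 'k"
  define w where "w h z = (\<Prod>A\<in>P. \<Prod>i\<in>- A. v (h A) i (z $ i))" for h and z :: "bool ^ 'n ^ 'k"
  have "(\<Sum>h\<in>S. u h x * w h z) = of_bool (x = z)" if xz: "x \<in> F" "z \<in> F" for x z
  proof -
    have "(\<Sum>h\<in>S. u h x * w h z) = (\<Prod>A\<in>P. array_of f (mix A (- A) x z))"
      unfolding v pure_tensor_mix S_def u_def w_def prod.distrib[symmetric]
      by (rule prod_sum_PiE[symmetric]) auto
    also have "\<dots> = of_bool (x = z)"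
    proof (cases "x = z")
      case True
      have "mix A (- A) z z = z" for A by (simp add: mix_def vec_eq_iff)
      then show ?thesis
        using F xz True by (simp add: array_of_def fooling_set_def)
    next
      case False
      then obtain A B where "A \<union> B = UNIV" "A \<inter> B = {}" and 0: "\<not> f (mix A B x z)"
        using F xz unfolding fooling_set_def by (metis (no_types))
      then have B: "B = - A" by blast
      have "f x" "f z" using F xz by (auto simp: fooling_set_def)
      then have "A \<in> P" using 0 by (auto simp: P_def B)
      moreover have "array_of f (mix A (- A) x z) = 0"
        using 0 by (simp add: array_of_def B)
      ultimately have "(\<Prod>A\<in>P. array_of f (mix A (- A) x z)) = 0"
        by (intro prod_zero) auto
      then show ?thesis
        using False by simp
    qed
    finally show ?thesis .
  qed
  then have "card F \<le> card S"
    by (rule card_le_if_biorthogonal_sum[rotated]) (auto simp: S_def intro: finite_PiE)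
  also have "card S = r ^ card P"
    by (simp add: S_def card_PiE)
  \<comment> \<open>Types are nonempty, so \<open>{}\<close> and \<open>UNIV\<close> differ and
    exactly two subsets are removed.\<close>
  also have "card P = 2 ^ CARD('k) - 2"
    by (simp add: P_def card_Diff_subset card_Pow)
  finally show ?thesis .
qed

lemma array_of_Not_decomposition:
  fixes f :: "bool ^ ('n::finite) ^ ('k::finite) \<Rightarrow> bool"
  assumes v: "\<And>x. array_of f x = (\<Sum>j<r. pure_tensor (v j) x)"
  obtains v' where "\<And>x. array_of (\<lambda>x. \<not> f x) x = (\<Sum>j<Suc r. pure_tensor (v' j) x)"
proof -
  obtain i0 :: 'k where True by simp
  \<comment> \<open>The sign goes into the single factor \<open>i0\<close>; placed in every factor
    it would give (-1)^k. The extra index \<open>r\<close> carries the all-ones tensor.\<close>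
  define v' where
    "v' j i a = (if j < r then (if i = i0 then - 1 else 1) * v j i a else 1)" for j i a
  have "pure_tensor (v' j) x = - pure_tensor (v j) x" if "j < r" for j x
    using that by (simp add: pure_tensor_def v'_def prod.distrib)
  moreover have "pure_tensor (v' r) x = 1" for x
    by (simp add: pure_tensor_def v'_def)
  ultimately have "(\<Sum>j<Suc r. pure_tensor (v' j) x) = 1 - array_of f x" for x
    by (simp add: v sum_negf)
  then show thesis
    by (intro that[of v']) (simp add: array_of_def)
qed

lemma powr_inverse_le_if_le_power:
  fixes t r m :: nat
  assumes "t \<le> r ^ m" "m > 0"
  shows "real t powr (1 / real m) \<le> real r"
proof (cases "r = 0")
  \<comment> \<open>The rewriting with \<open>powr_realpow\<close> needs a positive base. If r = 0,
    then m > 0 forces t = 0, and 0 \<open>powr\<close> anything is 0.\<close>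
  case False
  have "real t \<le> real r ^ m"
    using assms(1) by (metis of_nat_le_iff of_nat_power)
  then have "real t powr (1 / real m) \<le> (real r ^ m) powr (1 / real m)"
    by (intro powr_mono2) auto
  also have "\<dots> = real r"
    using False assms(2) by (simp add: powr_realpow[symmetric] powr_powr)
  finally show ?thesis .
qed (use assms in \<open>simp add: zero_power\<close>)

theorem theorem9:
  fixes f :: "bool ^ ('n::finite) ^ ('k::finite) \<Rightarrow> bool"
    and F :: "(bool ^ 'n ^ 'k) set"
    and b :: bool and t :: nat
  assumes "CARD('k) \<ge> 2"
    and "fooling_set b f F" and "card F = t"
  shows "(b \<longrightarrow> real (tensor_rank (array_of f)) \<ge> real t powr (1 / (2 ^ CARD('k) - 2))) \<and>
         (\<not> b \<longrightarrow> real (tensor_rank (array_of f)) + 1 \<ge> real t powr (1 / (2 ^ CARD('k) - 2)))"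
proof -
  let ?r = "tensor_rank (array_of f)" and ?m = "2 ^ CARD('k) - 2 :: nat"
  \<comment> \<open>At least two arguments make 2^k at least 4, so the subtraction on naturals is
    not truncated and the exponent is positive.\<close>
  have "(2::nat) ^ 2 \<le> 2 ^ CARD('k)"
    using assms(1) by (intro power_increasing) auto
  then have m: "?m > 0" "real ?m = 2 ^ CARD('k) - 2"
    by (simp_all add: of_nat_diff)
  obtain v where v: "\<And>x. array_of f x = (\<Sum>j<?r. pure_tensor (v j) x)"
    using tensor_rank_attained[of "array_of f"] by blast
  show ?thesis
  proof (cases b)
    case True
    then have "t \<le> ?r ^ ?m"
      using card_one_fooling_set_le[OF _ v] assms(2,3) by auto
    then show ?thesis
      using powr_inverse_le_if_le_power[OF _ m(1)] True m(2) by metis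
  next
    case False
    obtain v' where v': "\<And>x. array_of (\<lambda>x. \<not> f x) x = (\<Sum>j<Suc ?r. pure_tensor (v' j) x)"
      using array_of_Not_decomposition[OF v] by blast
    have "fooling_set True (\<lambda>x. \<not> f x) F"
      using assms(2) False by (auto simp: fooling_set_def)
    then have "t \<le> Suc ?r ^ ?m"
      using card_one_fooling_set_le[OF _ v'] assms(3) by blast
    then have "real t powr (1 / real ?m) \<le> real (Suc ?r)"
      by (rule powr_inverse_le_if_le_power[OF _ m(1)])
    then show ?thesis
      using False unfolding m(2) by simp
  qed
qed

end
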